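(* Let $0<|q|<1$ and let $a,x$ be complex numbers with $|x|<1$, $x\neq 0$, and $|q|<|a|$. For complex $u,v$ with $|v|<1$ define $\xi(u,v)=\sum_{k=0}^{\infty}(u;q)_k v^k$. Then $$\xi(a,x)=\sum_{k=0}^{\infty}\frac{q^{\binom{k}{2}}(-ax)^k}{(x;q)_{k+1}},$$ and $$\xi(a,x)-\frac{q}{ax}\,\xi(q/x,q/a)=\frac{(q,ax,q/(ax);q)_\infty}{(x,q/a;q)_\infty}.$$
   Context: For complex $y$ and integer $n\ge 0$: $(y;q)_\infty=\prod_{j=0}^{\infty}(1-yq^j)$, $(y;q)_n=(y;q)_\infty/(yq^n;q)_\infty$, and $(y_1,\dots,y_m;q)_\infty=(y_1;q)_\infty\cdots(y_m;q)_\infty$. *)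

theory Defs
  imports "HOL-Analysis.Analysis"
begin

definition qpoch_inf :: "complex \<Rightarrow> complex \<Rightarrow> complex" where
  "qpoch_inf q y = (\<Prod>j. 1 - y * q ^ j)"

(* The quotient (y;q)_oo / (y q^n;q)_oo is 0/0 when y q^(n+j) = 1 for some j, for instance for
   y = q^(-n); its continuous extension in y is the finite product below. The two agree wherever
   the quotient is defined, see qpoch_eq_quotient. *)
definition qpoch :: "complex \<Rightarrow> complex \<Rightarrow> nat \<Rightarrow> complex" where
  "qpoch q y n = (\<Prod>j<n. 1 - y * q ^ j)"

definition xi :: "complex \<Rightarrow> complex \<Rightarrow> complex \<Rightarrow> complex" where
  "xi q u v = (\<Sum>k. qpoch q u k * v ^ k)"

lemma convergent_prod_qpoch_inf:
  fixes q y :: complex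
  assumes "norm q < 1"
  shows "convergent_prod (\<lambda>j. 1 - y * q ^ j)"
proof -
  have "summable (\<lambda>j. norm y * norm q ^ j)"
    using assms by (intro summable_mult summable_geometric) auto
  moreover have "norm ((1 - y * q ^ j) - 1) = norm y * norm q ^ j" for j
    by (simp add: norm_mult norm_power)
  ultimately have "summable (\<lambda>j. norm ((1 - y * q ^ j) - 1))"
    by presburger
  then show ?thesis
    by (intro abs_convergent_prod_imp_convergent_prod summable_imp_abs_convergent_prod)
qed

lemma qpoch_inf_rec:
  assumes "norm q < 1"
  shows "qpoch_inf q y = (1 - y) * qpoch_inf q (y * q)"
proof -
  have 1: "(\<lambda>n. \<Prod>j\<le>n. 1 - z * q ^ j) \<longlonglongrightarrow> qpoch_inf q z" for z
    unfolding qpoch_inf_def using convergent_prod_qpoch_inf[OF assms]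
    by (rule convergent_prod_LIMSEQ)
  have "(\<lambda>n. \<Prod>j\<le>Suc n. 1 - y * q ^ j) = (\<lambda>n. (1 - y) * (\<Prod>j\<le>n. 1 - y * q * q ^ j))"
    by (simp only: prod.atMost_Suc_shift) (simp add: mult.assoc)
  moreover have "(\<lambda>n. (1 - y) * (\<Prod>j\<le>n. 1 - y * q * q ^ j)) \<longlonglongrightarrow> (1 - y) * qpoch_inf q (y * q)"
    by (intro tendsto_mult_left 1)
  moreover have "(\<lambda>n. \<Prod>j\<le>Suc n. 1 - y * q ^ j) \<longlonglongrightarrow> qpoch_inf q y"
    using 1[of y] by (rule LIMSEQ_Suc)
  ultimately show ?thesis
    using LIMSEQ_unique by metis
qed

lemma qpoch_eq_quotient:
  assumes "norm q < 1" and "qpoch_inf q (y * q ^ n) \<noteq> 0"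
  shows "qpoch q y n = qpoch_inf q y / qpoch_inf q (y * q ^ n)"
proof -
  have "qpoch_inf q y = qpoch q y n * qpoch_inf q (y * q ^ n)"
  proof (induction n)
    case 0
    show ?case by (simp add: qpoch_def)
  next
    case (Suc n)
    then show ?case
      using qpoch_inf_rec[OF assms(1), of "y * q ^ n"]
      by (simp add: qpoch_def mult_ac)
  qed
  then show ?thesis using assms(2) by simp
qed

lemma summable_xi:
  assumes "norm q < 1" and "norm v < 1"
  shows "summable (\<lambda>k. qpoch q u k * v ^ k)"
proof -
  obtain c where c: "norm v < c" "c < 1"
    using dense[OF assms(2)] by blast
  have "(\<lambda>k. norm ((1 - u * q ^ k) * v)) \<longlonglongrightarrow> norm ((1 - u * 0) * v)"
    using assms(1) by (intro tendsto_intros LIMSEQ_power_zero)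
  then have "eventually (\<lambda>k. norm ((1 - u * q ^ k) * v) < c) sequentially"
    using c(1) by (intro order_tendstoD(2)) auto
  then obtain N where N: "norm ((1 - u * q ^ k) * v) < c" if "k \<ge> N" for k
    by (auto simp: eventually_sequentially)
  show ?thesis
  proof (rule summable_ratio_test[OF c(2)])
    fix k assume "N \<le> k"
    have "norm (qpoch q u (Suc k) * v ^ Suc k)
        = norm ((1 - u * q ^ k) * v) * norm (qpoch q u k * v ^ k)"
      by (simp add: qpoch_def norm_mult mult_ac)
    also have "\<dots> \<le> c * norm (qpoch q u k * v ^ k)"
      using N[OF \<open>N \<le> k\<close>] by (intro mult_right_mono) auto
    finally show "norm (qpoch q u (Suc k) * v ^ Suc k) \<le> c * norm (qpoch q u k * v ^ k)" .
  qed
qed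

end

theory Submission
  imports Defs
begin

text \<open>
  The first identity iterates \<open>(1 - x) \<xi>(a, x) = 1 - a x \<xi>(a, q x)\<close>. By this identity the second
  one is Ramanujan's \<open>\<^sub>1\<psi>\<^sub>1\<close> summation with lower parameter \<open>b = 0\<close>. Following Ismail, for
  \<open>b = q\<^bsup>m+1\<^esup>\<close> the bilateral series terminates on the left and is a shifted \<open>q\<close>-binomial series;
  the case \<open>b = 0\<close> is its limit as \<open>m\<close> tends to infinity, by dominated convergence.
\<close>

section \<open>Finite and infinite q-shifted factorials\<close>

lemma qpoch_0 [simp]: "qpoch q y 0 = 1"
  by (simp add: qpoch_def)

lemma qpoch_Suc: "qpoch q y (Suc n) = qpoch q y n * (1 - y * q ^ n)"
  by (simp add: qpoch_def)

lemma qpoch_add: "qpoch q y (m + n) = qpoch q y m * qpoch q (y * q ^ m) n"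
  by (induction n) (simp_all add: qpoch_Suc power_add mult_ac)

lemma qpoch_inf_split:
  assumes "norm q < 1"
  shows "qpoch_inf q y = qpoch q y n * qpoch_inf q (y * q ^ n)"
proof (induction n)
  case (Suc n)
  then show ?case
    using qpoch_inf_rec[OF assms, of "y * q ^ n"] by (simp add: qpoch_Suc mult_ac)
qed simp

lemma qpoch_tendsto:
  assumes "norm q < 1"
  shows "qpoch q y \<longlonglongrightarrow> qpoch_inf q y"
proof -
  have "(\<lambda>n. \<Prod>j\<le>n. 1 - y * q ^ j) \<longlonglongrightarrow> qpoch_inf q y"
    unfolding qpoch_inf_def
    by (rule convergent_prod_LIMSEQ[OF convergent_prod_qpoch_inf[OF assms]])
  then have "(\<lambda>n. qpoch q y (Suc n)) \<longlonglongrightarrow> qpoch_inf q y"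
    by (simp add: qpoch_def lessThan_Suc_atMost)
  then show ?thesis
    by (rule LIMSEQ_imp_Suc)
qed

lemma norm_mult_power_less_1:
  fixes q z :: complex
  assumes "norm q < 1" "norm z < 1"
  shows "norm (z * q ^ n) < 1"
proof -
  have "norm (z * q ^ n) \<le> norm z * 1"
    unfolding norm_mult norm_power using assms by (intro mult_left_mono power_le_one) auto
  then show ?thesis
    using assms by simp
qed

lemma qpoch_factor_nonzero:
  fixes q y :: complex
  assumes "norm q < 1" "norm y < 1"
  shows "1 - y * q ^ n \<noteq> 0"
  using norm_mult_power_less_1[OF assms, of n] by auto

lemma qpoch_nonzero:
  assumes "norm q < 1" "norm y < 1"
  shows "qpoch q y n \<noteq> 0"
  using qpoch_factor_nonzero[OF assms] by (simp add: qpoch_def)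

lemma qpoch_inf_nonzero:
  assumes "norm q < 1" "norm y < 1"
  shows "qpoch_inf q y \<noteq> 0"
  unfolding qpoch_inf_def
  by (intro prodinf_nonzero convergent_prod_qpoch_inf qpoch_factor_nonzero assms)

lemma qpoch_bounded:
  assumes "norm q < 1"
  obtains K where "K > 0" "\<And>n. norm (qpoch q y n) \<le> K"
  using convergent_imp_Bseq[OF convergentI[OF qpoch_tendsto[OF assms]], of y]
  by (auto simp: Bseq_def)

lemma inverse_qpoch_bounded:
  assumes "norm q < 1" "norm y < 1"
  obtains K where "K > 0" "\<And>n. norm (inverse (qpoch q y n)) \<le> K"
proof -
  have "(\<lambda>n. inverse (qpoch q y n)) \<longlonglongrightarrow> inverse (qpoch_inf q y)"
    by (intro tendsto_inverse qpoch_tendsto qpoch_inf_nonzero assms)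
  then have "Bseq (\<lambda>n. inverse (qpoch q y n))"
    by (intro convergent_imp_Bseq convergentI)
  then show ?thesis
    using that by (auto simp: Bseq_def)
qed

lemma choose_2_Suc: "Suc n choose 2 = (n choose 2) + n"
  by (simp add: numeral_2_eq_2)

text \<open>Factor by factor, \<open>1 - y / q ^ i = (- y / q ^ i) * (1 - q ^ i / y)\<close> for i =
  1, ..., n. The exponents i add up to \<open>Suc n choose 2\<close>.\<close>

lemma qpoch_reverse:
  assumes "q \<noteq> 0" "y \<noteq> 0"
  shows "qpoch q (y / q ^ n) n = qpoch q (q / y) n * (- y) ^ n / q ^ (Suc n choose 2)"
proof (induction n)
  case (Suc n)
  have "qpoch q (y / q ^ Suc n) (Suc n) = (1 - y / q ^ Suc n) * qpoch q (y / q ^ n) n"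
    using qpoch_add[of q "y / q ^ Suc n" 1 n] assms by (simp add: qpoch_Suc)
  also have "1 - y / q ^ Suc n = (1 - q / y * q ^ n) * (- y) / q ^ Suc n"
    using assms by (simp add: field_simps)
  finally show ?case
    unfolding Suc.IH qpoch_Suc choose_2_Suc[of "Suc n"] power_add
    by (simp add: mult_ac)
qed (simp add: numeral_2_eq_2)

section \<open>Absolute convergence, and power series along \<open>z * q ^ n\<close>\<close>

text \<open>Consecutive terms have ratio \<open>w * q ^ n\<close>, which tends to 0 for every
  \<open>w\<close>. This matters later, where \<open>w\<close> involves \<open>q / x\<close> and may
  be large.\<close>

lemma summable_norm_power_choose_2:
  fixes q w :: complex
  assumes "norm q < 1"
  shows "summable (\<lambda>n. norm (q ^ (n choose 2) * w ^ n))"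
proof -
  have "(\<lambda>n. norm (w * q ^ n)) \<longlonglongrightarrow> norm (w * 0)"
    using assms by (intro tendsto_intros LIMSEQ_power_zero)
  then have "eventually (\<lambda>n. norm (w * q ^ n) < 1 / 2) sequentially"
    by (intro order_tendstoD(2)) auto
  then obtain N where N: "norm (w * q ^ n) < 1 / 2" if "n \<ge> N" for n
    by (auto simp: eventually_sequentially)
  show ?thesis
  proof (rule summable_ratio_test[of "1 / 2" N])
    fix n assume "N \<le> n"
    have "norm (q ^ (Suc n choose 2) * w ^ Suc n)
        = norm (w * q ^ n) * norm (q ^ (n choose 2) * w ^ n)"
      by (simp add: choose_2_Suc power_add norm_mult)
    also have "\<dots> \<le> 1 / 2 * norm (q ^ (n choose 2) * w ^ n)"
      using N[OF \<open>N \<le> n\<close>] by (intro mult_right_mono) auto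
    finally show "norm (norm (q ^ (Suc n choose 2) * w ^ Suc n))
        \<le> 1 / 2 * norm (norm (q ^ (n choose 2) * w ^ n))"
      by simp
  qed simp
qed

text \<open>A power series that converges at a real \<open>c\<close> with
  \<open>norm v < c < 1\<close> converges absolutely at \<open>v\<close>.\<close>

lemma summable_norm_xi:
  assumes "norm q < 1" "norm v < 1"
  shows "summable (\<lambda>k. norm (qpoch q u k * v ^ k))"
proof -
  obtain c where c: "norm v < c" "c < 1"
    using dense[OF assms(2)] by blast
  then have "norm (of_real c :: complex) = c"
    by (simp add: abs_of_pos[OF le_less_trans[OF norm_ge_zero]])
  then show ?thesis
    using c by (intro powser_insidea[OF summable_xi[OF assms(1), of "of_real c"]]) simp_all
qed

text \<open>Continuity at 0. It supplies the limit of the last factor whenever a functional equation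
  relating \<open>z\<close> and \<open>z * q\<close> is iterated.\<close>

lemma powser_tendsto_geometric:
  fixes c :: "nat \<Rightarrow> complex"
  assumes "norm q < 1" and "\<And>w. norm w < 1 \<Longrightarrow> summable (\<lambda>k. c k * w ^ k)"
  shows "(\<lambda>n. \<Sum>k. c k * (z * q ^ n) ^ k) \<longlonglongrightarrow> c 0"
proof -
  have "isCont (\<lambda>w. \<Sum>k. c k * w ^ k) 0"
    by (rule isCont_powser[of _ "1 / 2"]) (auto intro!: assms(2) simp: norm_divide)
  moreover have "(\<lambda>n. z * q ^ n) \<longlonglongrightarrow> 0"
    using tendsto_mult_right_zero[OF LIMSEQ_power_zero[OF assms(1)]] by blast
  ultimately have "(\<lambda>n. \<Sum>k. c k * (z * q ^ n) ^ k) \<longlonglongrightarrow> (\<Sum>k. c k * 0 ^ k)"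
    by (rule isCont_tendsto_compose)
  then show ?thesis
    by (simp only: powser_zero)
qed

subsection \<open>The first identity\<close>

text \<open>After removing the term for k = 0, the new factor \<open>1 - a * q ^ k\<close> splits
  each term in two, and \<open>q ^ k\<close> is absorbed by replacing \<open>x\<close> with
  \<open>x * q\<close>.\<close>

lemma xi_rec:
  assumes "norm q < 1" "norm x < 1"
  shows "(1 - x) * xi q a x = 1 - a * x * xi q a (x * q)"
proof -
  have xq: "norm (x * q) < 1"
    using norm_mult_power_less_1[OF assms, of 1] by simp
  note s1 = summable_xi[OF assms, of a]
  note s2 = summable_xi[OF assms(1) xq, of a]
  have "xi q a x - 1 = (\<Sum>k. qpoch q a (Suc k) * x ^ Suc k)"
    unfolding xi_def by (subst suminf_split_head[OF s1]) simp
  also have "\<dots> = (\<Sum>k. x * (qpoch q a k * x ^ k) - a * x * (qpoch q a k * (x * q) ^ k))"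
    by (intro suminf_cong) (simp add: qpoch_Suc algebra_simps)
  also have "\<dots> = x * xi q a x - a * x * xi q a (x * q)"
    unfolding xi_def
    by (subst suminf_diff[symmetric])
      (intro summable_mult s1 s2 | simp only: suminf_mult s1 s2)+
  finally show ?thesis
    by (simp add: algebra_simps)
qed

text \<open>Each use of \<open>xi_rec\<close> at \<open>x * q ^ j\<close> contributes the factor
  \<open>- (a * x) * q ^ j / (1 - x * q ^ j)\<close>; the powers of \<open>q\<close> for j < k
  collect to \<open>q ^ (k choose 2)\<close>.\<close>

lemma xi_partial:
  assumes "norm q < 1" "norm x < 1"
  shows "xi q a x = (\<Sum>k<n. q ^ (k choose 2) * (- (a * x)) ^ k / qpoch q x (k + 1))
    + q ^ (n choose 2) * (- (a * x)) ^ n / qpoch q x n * xi q a (x * q ^ n)"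
proof (induction n)
  case (Suc n)
  let ?y = "x * q ^ n"
  have nz: "1 - ?y \<noteq> 0" "qpoch q x n \<noteq> 0"
    using qpoch_factor_nonzero[OF assms] qpoch_nonzero[OF assms] by auto
  have "xi q a ?y = (1 - a * ?y * xi q a (?y * q)) / (1 - ?y)"
    using xi_rec[OF assms(1) norm_mult_power_less_1[OF assms], of n a] nz
    by (simp add: field_simps)
  then have "q ^ (n choose 2) * (- (a * x)) ^ n / qpoch q x n * xi q a ?y
     = q ^ (n choose 2) * (- (a * x)) ^ n / qpoch q x (Suc n)
       + q ^ (Suc n choose 2) * (- (a * x)) ^ Suc n / qpoch q x (Suc n) * xi q a (x * q ^ Suc n)"
    by (simp add: qpoch_Suc choose_2_Suc power_add diff_divide_distrib right_diff_distrib mult_ac)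
  then show ?case
    using Suc.IH by simp
qed (simp add: binomial_eq_0)

lemma xi_sums:
  assumes "norm q < 1" "norm x < 1"
  shows "(\<lambda>k. q ^ (k choose 2) * (- (a * x)) ^ k / qpoch q x (k + 1)) sums xi q a x"
proof -
  \<comment> \<open>This factor alone kills the remainder: the factors
    \<open>1 / qpoch q x n\<close> and \<open>xi q a (x * q ^ n)\<close> have finite limits.\<close>
  have "(\<lambda>n. q ^ (n choose 2) * (- (a * x)) ^ n) \<longlonglongrightarrow> 0"
    by (intro summable_LIMSEQ_zero summable_norm_cancel[OF summable_norm_power_choose_2] assms)
  moreover have "(\<lambda>n. xi q a (x * q ^ n)) \<longlonglongrightarrow> 1"
    unfolding xi_def
    using powser_tendsto_geometric[OF assms(1) summable_xi[OF assms(1)]] by simp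
  ultimately have "(\<lambda>n. q ^ (n choose 2) * (- (a * x)) ^ n / qpoch q x n * xi q a (x * q ^ n))
      \<longlonglongrightarrow> 0 / qpoch_inf q x * 1"
    by (intro tendsto_mult tendsto_divide qpoch_tendsto qpoch_inf_nonzero assms)
  then have "(\<lambda>n. xi q a x
      - q ^ (n choose 2) * (- (a * x)) ^ n / qpoch q x n * xi q a (x * q ^ n))
      \<longlonglongrightarrow> xi q a x - 0"
    by (intro tendsto_diff tendsto_const) simp
  moreover have "xi q a x
      - q ^ (n choose 2) * (- (a * x)) ^ n / qpoch q x n * xi q a (x * q ^ n)
      = (\<Sum>k<n. q ^ (k choose 2) * (- (a * x)) ^ k / qpoch q x (k + 1))" for n
    by (subst xi_partial[OF assms, of a n]) simp
  ultimately show ?thesis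
    unfolding sums_def by simp
qed

subsection \<open>The \<open>q\<close>-binomial theorem\<close>

text \<open>The inverses of the denominators are bounded, so the absolutely convergent series of
  \<open>xi q A z\<close> dominates.\<close>

lemma summable_q_binomial:
  assumes "norm q < 1" "norm z < 1"
  shows "summable (\<lambda>k. qpoch q A k / qpoch q q k * z ^ k)"
proof -
  obtain K where K: "\<And>n. norm (inverse (qpoch q q n)) \<le> K"
    using inverse_qpoch_bounded[OF assms(1,1)] by blast
  have "summable (\<lambda>k. K * norm (qpoch q A k * z ^ k))"
    by (intro summable_mult summable_norm_xi assms)
  moreover have "norm (qpoch q A k / qpoch q q k * z ^ k) \<le> K * norm (qpoch q A k * z ^ k)" for k
  proof -
    have "norm (qpoch q A k / qpoch q q k * z ^ k)
        = norm (inverse (qpoch q q k)) * norm (qpoch q A k * z ^ k)"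
      by (simp add: norm_mult norm_divide norm_inverse divide_inverse)
    also have "\<dots> \<le> K * norm (qpoch q A k * z ^ k)"
      by (intro mult_right_mono K) auto
    finally show ?thesis .
  qed
  ultimately show ?thesis
    by (rule summable_comparison_test'[where N = 0])
qed

text \<open>In \<open>F z - F (z * q)\<close> the coefficient of \<open>z ^ Suc k\<close> gains the
  factor \<open>1 - q ^ Suc k\<close>, which cancels the last factor of
  \<open>qpoch q q (Suc k)\<close>.\<close>

lemma q_binomial_rec:
  fixes q A :: complex
  defines "F \<equiv> \<lambda>z. \<Sum>k. qpoch q A k / qpoch q q k * z ^ k"
  assumes "norm q < 1" "norm z < 1"
  shows "(1 - z) * F z = (1 - A * z) * F (z * q)"
proof -
  let ?c = "\<lambda>k. qpoch q A k / qpoch q q k"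
  have zq: "norm (z * q) < 1"
    using norm_mult_power_less_1[OF assms(2,3), of 1] by simp
  note s1 = summable_q_binomial[OF assms(2,3), of A]
  note s2 = summable_q_binomial[OF assms(2) zq, of A]
  have "F z - F (z * q) = (\<Sum>k. ?c k * z ^ k - ?c k * (z * q) ^ k)"
    unfolding F_def by (rule suminf_diff[OF s1 s2])
  \<comment> \<open>The term for k = 0 of the difference vanishes, so the shift leaves no
    constant.\<close>
  also have "\<dots> = (\<Sum>k. ?c (Suc k) * z ^ Suc k - ?c (Suc k) * (z * q) ^ Suc k)"
    by (subst suminf_split_head[OF summable_diff[OF s1 s2]]) simp
  also have "\<dots> = (\<Sum>k. z * (?c k * z ^ k) - A * z * (?c k * (z * q) ^ k))"
  proof (rule suminf_cong)
    fix k
    have "1 - q * q ^ k \<noteq> 0" "qpoch q q k \<noteq> 0"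
      using qpoch_factor_nonzero[OF assms(2,2)] qpoch_nonzero[OF assms(2,2)] by auto
    then have "?c (Suc k) * (1 - q * q ^ k) = ?c k * (1 - A * q ^ k)"
      by (simp add: qpoch_Suc)
    moreover have "?c (Suc k) * z ^ Suc k - ?c (Suc k) * (z * q) ^ Suc k
        = ?c (Suc k) * (1 - q * q ^ k) * z ^ Suc k"
      by (simp only: power_mult_distrib power_Suc ring_distribs mult_1_right mult_1_left mult_ac)
    ultimately show "?c (Suc k) * z ^ Suc k - ?c (Suc k) * (z * q) ^ Suc k
        = z * (?c k * z ^ k) - A * z * (?c k * (z * q) ^ k)"
      by (simp add: power_mult_distrib right_diff_distrib diff_divide_distrib mult_ac)
  qed
  also have "\<dots> = z * F z - A * z * F (z * q)"
    unfolding F_def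
    by (subst suminf_diff[symmetric])
      (intro summable_mult s1 s2 | simp only: suminf_mult s1 s2)+
  finally show ?thesis
    by (simp add: algebra_simps)
qed

text \<open>Iterating \<open>q_binomial_rec\<close> moves the argument to \<open>z * q ^ n\<close>,
  where \<open>F\<close> tends to \<open>F 0 = 1\<close>; the accumulated factors tend to the
  infinite products.\<close>

lemma q_binomial_theorem:
  assumes "norm q < 1" "norm z < 1"
  shows "(\<Sum>k. qpoch q A k / qpoch q q k * z ^ k) = qpoch_inf q (A * z) / qpoch_inf q z"
proof -
  define F where "F = (\<lambda>z. \<Sum>k. qpoch q A k / qpoch q q k * z ^ k)"
  have eq: "F z = qpoch q (A * z) n / qpoch q z n * F (z * q ^ n)" for n
  proof (induction n)
    case (Suc n)
    let ?y = "z * q ^ n"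
    have "1 - ?y \<noteq> 0"
      by (rule qpoch_factor_nonzero[OF assms])
    moreover have "(1 - ?y) * F ?y = (1 - A * ?y) * F (?y * q)"
      unfolding F_def by (rule q_binomial_rec[OF assms(1) norm_mult_power_less_1[OF assms]])
    ultimately have "F ?y = (1 - A * ?y) * F (?y * q) / (1 - ?y)"
      by (simp add: field_simps)
    with Suc.IH show ?case
      by (simp add: qpoch_Suc mult_ac)
  qed simp
  have "(\<lambda>n. F (z * q ^ n)) \<longlonglongrightarrow> 1"
    unfolding F_def
    using powser_tendsto_geometric[OF assms(1) summable_q_binomial[OF assms(1)]] by simp
  then have "(\<lambda>n. qpoch q (A * z) n / qpoch q z n * F (z * q ^ n))
      \<longlonglongrightarrow> qpoch_inf q (A * z) / qpoch_inf q z * 1"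
    by (intro tendsto_mult tendsto_divide qpoch_tendsto qpoch_inf_nonzero assms)
  then have "F z = qpoch_inf q (A * z) / qpoch_inf q z"
    unfolding eq[symmetric] by (simp add: LIMSEQ_const_iff)
  then show ?thesis
    by (simp add: F_def)
qed

subsection \<open>The second identity\<close>

text \<open>Ramanujan's summation for the lower parameter \<open>q\<^bsup>m+1\<^esup>\<close>.\<close>

lemma terminating_psi_sum:
  assumes "0 < norm q" "norm q < 1" "norm x < 1" "x \<noteq> 0" "norm q < norm a"
  shows "(\<Sum>n. qpoch q a n * x ^ n * (qpoch q q m / qpoch q q (m + n)))
     - q / (a * x) * (\<Sum>n. if n < m
         then q ^ (n choose 2) * (- (q / x * (q / a))) ^ n / qpoch q (q / a) (n + 1)
              * (qpoch q q m / qpoch q q (m - Suc n)) else 0)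
    = qpoch q q m * qpoch q (q / (a * x)) m * qpoch_inf q (a * x)
      / (qpoch q (q / a) m * qpoch_inf q x)"
proof -
  have nz: "q \<noteq> 0" "a \<noteq> 0" "norm (q / a) < 1"
    using assms by (auto simp: norm_divide divide_less_eq_1)
  have qa: "qpoch q (q / a) n \<noteq> 0" for n
    by (rule qpoch_nonzero[OF assms(2) nz(3)])
  have qq: "qpoch q q n \<noteq> 0" for n
    by (rule qpoch_nonzero[OF assms(2,2)])
  \<comment> \<open>Reversal reduces this to \<open>qpoch q (q / a) n\<close>, which is nonzero
    because \<open>norm q < norm a\<close>.\<close>
  have am: "qpoch q (a / q ^ n) n \<noteq> 0" for n
    using qa nz by (simp add: qpoch_reverse)
  \<comment> \<open>\<open>P\<close> is \<open>1 / T m\<close>, so that \<open>T m\<close> becomes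
    the term of bilateral index 0, normalised to 1.\<close>
  define P where "P = qpoch q q m / (x ^ m * qpoch q (a / q ^ m) m)"
  define T where "T = (\<lambda>k. qpoch q (a / q ^ m) k / qpoch q q k * x ^ k)"
  have sT: "summable T"
    unfolding T_def by (rule summable_q_binomial[OF assms(2,3)])
  have right: "P * T (n + m) = qpoch q a n * x ^ n * (qpoch q q m / qpoch q q (m + n))" for n
    using am[of m] qq nz assms(4) qpoch_add[of q "a / q ^ m" m n]
    by (simp add: P_def T_def power_add add.commute[of n m])
  \<comment> \<open>The index \<open>m - Suc n\<close> of \<open>T\<close> is the bilateral index
    -(n+1). The offset by one produces the prefactor \<open>- (q / (a * x))\<close>.\<close>
  have left: "P * T (m - Suc n) = - (q / (a * x)) *
      (q ^ (n choose 2) * (- (q / x * (q / a))) ^ n / qpoch q (q / a) (n + 1)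
              * (qpoch q q m / qpoch q q (m - Suc n)))" if "n < m" for n
  proof -
    define l where "l = m - Suc n"
    have m: "m = l + Suc n"
      using that by (simp add: l_def)
    \<comment> \<open>The first \<open>l\<close> factors cancel against the numerator of
      \<open>T l\<close>. What remains has base \<open>a / q ^ Suc n\<close>, free of
      \<open>m\<close>, and can be reversed.\<close>
    have "qpoch q (a / q ^ m) m = qpoch q (a / q ^ m) l * qpoch q (a / q ^ Suc n) (Suc n)"
      using qpoch_add[of q "a / q ^ m" l "Suc n"] nz unfolding m by (simp add: power_add)
    moreover have "qpoch q (a / q ^ m) l \<noteq> 0"
      using am[of m] calculation by auto
    ultimately have "P * T l = qpoch q q m / qpoch q q l
        * (1 / (x ^ Suc n * qpoch q (a / q ^ Suc n) (Suc n)))"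
      using assms(4) am[of "Suc n"] by (simp add: P_def T_def m power_add)
    also have "1 / (x ^ Suc n * qpoch q (a / q ^ Suc n) (Suc n))
        = - (q / (a * x)) * (q ^ (n choose 2) * (- (q / x * (q / a))) ^ n / qpoch q (q / a) (n + 1))"
    proof -
      \<comment> \<open>The sign is attached to \<open>a\<close> to match the power of
        \<open>- a\<close> that \<open>qpoch_reverse\<close> produces.\<close>
      have "- (q / x * (q / a)) = q * q / (x * - a)"
        by simp
      then have "(- (q / x * (q / a))) ^ n = q ^ n * q ^ n / (x ^ n * (- a) ^ n)"
        by (simp only: power_divide power_mult_distrib)
      then show ?thesis
        unfolding qpoch_reverse[OF nz(1,2)] choose_2_Suc power_add
        using nz assms(4) qa[of "Suc n"] by (simp add: field_simps)
    qed
    finally show ?thesis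
      by (simp add: l_def mult_ac)
  qed
  \<comment> \<open>The terms from \<open>m\<close> on form the nonnegative half of the bilateral
    series; the first \<open>m\<close> terms, in reverse order, form the negative half.\<close>
  have "P * suminf T = (\<Sum>n. P * T (n + m)) + (\<Sum>k<m. P * T k)"
    by (subst suminf_split_initial_segment[OF sT, of m])
      (simp add: distrib_left suminf_mult summable_iff_shift sT sum_distrib_left)
  also have "(\<Sum>k<m. P * T k) = (\<Sum>n<m. P * T (m - Suc n))"
    by (rule sum.nat_diff_reindex[symmetric])
  also have "\<dots> = - (q / (a * x)) * (\<Sum>n<m.
      q ^ (n choose 2) * (- (q / x * (q / a))) ^ n / qpoch q (q / a) (n + 1)
              * (qpoch q q m / qpoch q q (m - Suc n)))"
    unfolding sum_distrib_left by (intro sum.cong refl left) simp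
  also have "(\<Sum>n<m. q ^ (n choose 2) * (- (q / x * (q / a))) ^ n / qpoch q (q / a) (n + 1)
              * (qpoch q q m / qpoch q q (m - Suc n)))
      = (\<Sum>n. if n < m
         then q ^ (n choose 2) * (- (q / x * (q / a))) ^ n / qpoch q (q / a) (n + 1)
              * (qpoch q q m / qpoch q q (m - Suc n)) else 0)"
    by (subst suminf_finite[of "{..<m}"]) auto
  finally have 1: "P * suminf T = (\<Sum>n. qpoch q a n * x ^ n * (qpoch q q m / qpoch q q (m + n)))
     - q / (a * x) * (\<Sum>n. if n < m
         then q ^ (n choose 2) * (- (q / x * (q / a))) ^ n / qpoch q (q / a) (n + 1)
              * (qpoch q q m / qpoch q q (m - Suc n)) else 0)"
    by (simp only: right) simp
  have "suminf T = qpoch_inf q (a * x / q ^ m) / qpoch_inf q x"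
    unfolding T_def by (subst q_binomial_theorem[OF assms(2,3)]) simp
  \<comment> \<open>Reversing these \<open>m\<close> factors yields
    \<open>qpoch q (q / (a * x)) m\<close>. The powers of \<open>q\<close>, \<open>x\<close> and
    \<open>- a\<close> that appear cancel against those in \<open>P\<close>.\<close>
  also have "qpoch_inf q (a * x / q ^ m) = qpoch q (a * x / q ^ m) m * qpoch_inf q (a * x)"
    using qpoch_inf_split[OF assms(2), of "a * x / q ^ m" m] nz by simp
  finally have "P * suminf T = qpoch q q m * qpoch q (q / (a * x)) m * qpoch_inf q (a * x)
      / (qpoch q (q / a) m * qpoch_inf q x)"
    using nz assms(4) qa[of m]
    by (simp add: P_def qpoch_reverse power_mult_distrib power_minus[of "a"] power_minus[of "a * x"])
  with 1 show ?thesis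
    by simp
qed

section \<open>Passage to the limit in m\<close>

text \<open>Tannery's theorem with majorant \<open>norm (f k) * K\<close>: uniformly bounded weights
  tending to 1 disappear in the limit.\<close>

lemma suminf_dominated:
  fixes f :: "nat \<Rightarrow> complex"
  assumes "summable (\<lambda>k. norm (f k))" and "\<And>k m. norm (g k m) \<le> K"
    and "\<And>k. g k \<longlonglongrightarrow> 1"
  shows "(\<lambda>m. \<Sum>k. f k * g k m) \<longlonglongrightarrow> suminf f"
proof -
  have "(\<lambda>m. f k * g k m) \<longlonglongrightarrow> f k" for k
    using tendsto_mult_left[OF assms(3), of "f k" k] by simp
  moreover have "norm (f k * g k m) \<le> norm (f k) * K" for k m
    unfolding norm_mult by (intro mult_left_mono assms(2)) simp
  moreover from this have "eventually (\<lambda>(k, m). norm (f k * g k m) \<le> norm (f k) * K)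
      (sequentially \<times>\<^sub>F sequentially)"
    by (intro always_eventually) auto
  ultimately show ?thesis
    using tannerys_theorem[of "\<lambda>k m. f k * g k m" f sequentially "\<lambda>k. norm (f k) * K"]
      summable_mult2[OF assms(1)] sequentially_bot by blast
qed

text \<open>Both sides of \<open>terminating_psi_sum\<close> converge as m grows. Since
  \<open>norm (q / a) < 1\<close>, \<open>xi_sums\<close> identifies the limiting negative half as
  \<open>xi q (q / x) (q / a)\<close>, whatever the size of \<open>q / x\<close>.\<close>

lemma xi_reflection:
  assumes "0 < norm q" "norm q < 1" "norm x < 1" "x \<noteq> 0" "norm q < norm a"
  shows "xi q a x - q / (a * x) * xi q (q / x) (q / a)
        = (qpoch_inf q q * qpoch_inf q (a * x) * qpoch_inf q (q / (a * x)))
          / (qpoch_inf q x * qpoch_inf q (q / a))"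
proof -
  have nz: "q \<noteq> 0" "a \<noteq> 0" "norm (q / a) < 1"
    using assms by (auto simp: norm_divide divide_less_eq_1)
  define f where
    "f = (\<lambda>n. q ^ (n choose 2) * (- (q / x * (q / a))) ^ n / qpoch q (q / a) (n + 1))"
  have f: "f sums xi q (q / x) (q / a)"
    unfolding f_def by (rule xi_sums[OF assms(2) nz(3)])
  obtain K1 where K1: "K1 > 0" "\<And>n. norm (qpoch q q n) \<le> K1"
    using qpoch_bounded[OF assms(2)] by blast
  obtain K2 where K2: "K2 > 0" "\<And>n. norm (inverse (qpoch q q n)) \<le> K2"
    using inverse_qpoch_bounded[OF assms(2,2)] by blast
  obtain K3 where K3: "K3 > 0" "\<And>n. norm (inverse (qpoch q (q / a) n)) \<le> K3"
    using inverse_qpoch_bounded[OF assms(2) nz(3)] by blast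
  have K: "norm (qpoch q q m / qpoch q q n) \<le> K1 * K2" for m n
    unfolding divide_inverse norm_mult using K1 K2 by (intro mult_mono) auto
  have qq: "qpoch_inf q q \<noteq> 0"
    by (rule qpoch_inf_nonzero[OF assms(2,2)])
  have "(\<lambda>m. \<Sum>n. qpoch q a n * x ^ n * (qpoch q q m / qpoch q q (m + n))) \<longlonglongrightarrow> xi q a x"
    unfolding xi_def
  proof (rule suminf_dominated[OF summable_norm_xi[OF assms(2,3)] K])
    fix n
    have "(\<lambda>m. qpoch q q m / qpoch q q (m + n)) \<longlonglongrightarrow> qpoch_inf q q / qpoch_inf q q"
      by (intro tendsto_divide LIMSEQ_ignore_initial_segment qpoch_tendsto assms qq)
    then show "(\<lambda>m. qpoch q q m / qpoch q q (m + n)) \<longlonglongrightarrow> 1"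
      using qq by simp
  qed
  \<comment> \<open>Setting the weight to 0 for \<open>n >= m\<close> turns the finite sums into
    infinite ones with fixed terms \<open>f n\<close>.\<close>
  moreover have "(\<lambda>m. \<Sum>n. f n * (if n < m then qpoch q q m / qpoch q q (m - Suc n) else 0))
      \<longlonglongrightarrow> suminf f"
  proof (rule suminf_dominated)
    have "norm (f n) \<le> norm (q ^ (n choose 2) * (- (q / x * (q / a))) ^ n) * K3" for n
      unfolding f_def divide_inverse[of "_ * _ ^ _"] norm_mult[of "_ * _ ^ _"]
      by (intro mult_left_mono K3) simp
    then show "summable (\<lambda>n. norm (f n))"
      by (intro summable_comparison_test'[OF summable_mult2[OF
            summable_norm_power_choose_2[OF assms(2)]], where N = 0]) auto
    show "norm (if n < m then qpoch q q m / qpoch q q (m - Suc n) else 0) \<le> K1 * K2" for n m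
      using K K1(1) K2(1) by simp
  next
    fix n
    \<comment> \<open>Along \<open>m + Suc n\<close> the condition always holds and the natural
      subtraction is exact; \<open>LIMSEQ_offset\<close> then returns to \<open>m\<close>.\<close>
    have "(\<lambda>m. qpoch q q (m + Suc n) / qpoch q q m) \<longlonglongrightarrow> qpoch_inf q q / qpoch_inf q q"
      by (intro tendsto_divide LIMSEQ_ignore_initial_segment qpoch_tendsto assms qq)
    then have "(\<lambda>m. if n < m + Suc n then qpoch q q (m + Suc n) / qpoch q q (m + Suc n - Suc n)
        else 0) \<longlonglongrightarrow> 1"
      using qq by simp
    then show "(\<lambda>m. if n < m then qpoch q q m / qpoch q q (m - Suc n) else 0) \<longlonglongrightarrow> 1"
      by (rule LIMSEQ_offset)
  qed
  ultimately have "(\<lambda>m. (\<Sum>n. qpoch q a n * x ^ n * (qpoch q q m / qpoch q q (m + n)))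
      - q / (a * x) * (\<Sum>n. f n * (if n < m then qpoch q q m / qpoch q q (m - Suc n) else 0)))
      \<longlonglongrightarrow> xi q a x - q / (a * x) * suminf f"
    by (intro tendsto_diff tendsto_mult_left)
  moreover have "(\<lambda>m. qpoch q q m * qpoch q (q / (a * x)) m * qpoch_inf q (a * x)
      / (qpoch q (q / a) m * qpoch_inf q x))
      \<longlonglongrightarrow> qpoch_inf q q * qpoch_inf q (q / (a * x)) * qpoch_inf q (a * x)
      / (qpoch_inf q (q / a) * qpoch_inf q x)"
    using qpoch_inf_nonzero[OF assms(2) nz(3)] qpoch_inf_nonzero[OF assms(2,3)]
    by (intro tendsto_divide tendsto_mult tendsto_const qpoch_tendsto assms) auto
  moreover have "(\<Sum>n. qpoch q a n * x ^ n * (qpoch q q m / qpoch q q (m + n)))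
      - q / (a * x) * (\<Sum>n. f n * (if n < m then qpoch q q m / qpoch q q (m - Suc n) else 0))
      = qpoch q q m * qpoch q (q / (a * x)) m * qpoch_inf q (a * x)
      / (qpoch q (q / a) m * qpoch_inf q x)" for m
    unfolding terminating_psi_sum[OF assms, symmetric] f_def if_distrib[of "(*) _"] mult_zero_right ..
  ultimately have "xi q a x - q / (a * x) * suminf f
      = qpoch_inf q q * qpoch_inf q (q / (a * x)) * qpoch_inf q (a * x)
      / (qpoch_inf q (q / a) * qpoch_inf q x)"
    by (simp add: LIMSEQ_unique)
  then show ?thesis
    using sums_unique[OF f] by (simp add: mult_ac)
qed

theorem theorem4p1:
  fixes q a x :: complex
  assumes "0 < norm q" and "norm q < 1"
    and "norm x < 1" and "x \<noteq> 0"
    and "norm q < norm a"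
  shows "(\<lambda>k. q ^ (k choose 2) * (- (a * x)) ^ k / qpoch q x (k + 1)) sums xi q a x
    \<and> xi q a x - q / (a * x) * xi q (q / x) (q / a)
        = (qpoch_inf q q * qpoch_inf q (a * x) * qpoch_inf q (q / (a * x)))
          / (qpoch_inf q x * qpoch_inf q (q / a))"
  using xi_sums[OF assms(2,3)] xi_reflection[OF assms] by blast

end
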